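(* Consider the pendulum skate with an internal rotor described in the context, with the control law $u=\frac{J_1^2}{\sigma}\dot v^1$, where $\sigma\in\mathbb R\setminus\{0\}$ is a constant. For any $Y_0\in\mathbb R$, the sliding equilibrium $\zeta_{\rm sl}=(0,0,Y_0,0,1)$ of the controlled system, in the variables $\zeta=(v^1,v^2,v^3,\Gamma_2,\Gamma_3)$, is stable if $$-\frac{J_1^2}{I_1+ml^2}<\sigma<0.$$
   Context: Parameters: $m,l,\mathrm g,I_1,I_2,I_3,J_1,J_2,J_3>0$, where $m$ is the total mass including the rotor, $l$ the distance from the blade--ice contact point to the center of mass, $\mathrm g$ the gravitational acceleration, $I_i$ the moments of inertia of the skate and $J_i$ those of the rotor; $\mathcal I_i:=I_i+J_i$. The paper's standing assumption is $I_2>I_3$. The rotor has angle $\theta$, is attached at the center of mass, and its axis is aligned with the edge of the skate (first body axis). In quasivelocities $v^1,v^2,v^3$ (superscripts are indices) and components $(\Gamma_2,\Gamma_3)$ of the vertical unit vector $(0,\Gamma_2,\Gamma_3)$ seen from the body frame (so that $\Gamma_2^2+\Gamma_3^2=1$ for the physical system), the equations of motion with torque $u$ applied to the rotor are $$\frac{d}{dt}\bigl[(\mathcal I_1+ml^2)v^1+J_1\dot\theta\bigr]=(\mathcal I_2+ml^2-\mathcal I_3)\Gamma_2\Gamma_3(v^2)^2+ml\,\Gamma_3v^2v^3+m\mathrm g l\,\Gamma_2,$$ $$\frac{d}{dt}\bigl[((\mathcal I_2+ml^2)\Gamma_2^2+\mathcal I_3\Gamma_3^2)v^2+ml\,\Gamma_2v^3\bigr]=ml\,\Gamma_3v^3v^1,\qquad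 \frac{d}{dt}\bigl[m(l\,\Gamma_2v^2+v^3)\bigr]=-ml\,\Gamma_3v^1v^2,$$ $$\frac{d}{dt}\bigl[J_1(v^1+\dot\theta)\bigr]=u,\qquad \dot\Gamma_2=v^1\Gamma_3,\qquad \dot\Gamma_3=-v^1\Gamma_2.$$ With $u=\frac{J_1^2}{\sigma}\dot v^1$ the first and fourth equations give $$\Bigl(I_1+ml^2+\frac{J_1^2}{\sigma}\Bigr)\dot v^1=(\mathcal I_2+ml^2-\mathcal I_3)\Gamma_2\Gamma_3(v^2)^2+ml\,\Gamma_3v^2v^3+m\mathrm g l\,\Gamma_2,$$ so the equations for $\zeta=(v^1,v^2,v^3,\Gamma_2,\Gamma_3)$ form a closed system. "Stable" means Lyapunov stable as an equilibrium of this closed system for $\zeta$. *)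

theory Defs
  imports "HOL-Analysis.Analysis"
begin

text \<open>
  Conventions: \<open>m\<close> is the total mass (rotor included), \<open>l\<close> the distance from the contact point to
  the center of mass, \<open>g\<close> the gravitational acceleration, \<open>Ii\<close> and \<open>Ji\<close> the moments of inertia
  of the skate and of the rotor, so that \<open>Ii + Ji\<close> is the calligraphic \<open>I\<^sub>i\<close>.
  The \<open>vi\<close> are the quasivelocities and \<open>\<Gamma>2\<close>, \<open>\<Gamma>3\<close> the components of the vertical unit
  vector in the body frame.
\<close>

text \<open>Right-hand side of the first equation of motion.\<close>

definition skate_force ::
  "real \<Rightarrow> real \<Rightarrow> real \<Rightarrow> real \<Rightarrow> real \<Rightarrow> real \<Rightarrow> real \<Rightarrow> real \<times> real \<times> real \<times> real \<times> real \<Rightarrow> real"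
where
  "skate_force m l g I2 I3 J2 J3 = (\<lambda>(v1, v2, v3, \<Gamma>2, \<Gamma>3).
     ((I2 + J2) + m * l\<^sup>2 - (I3 + J3)) * \<Gamma>2 * \<Gamma>3 * v2\<^sup>2
       + m * l * \<Gamma>3 * v2 * v3 + m * g * l * \<Gamma>2)"

text \<open>
  The second and third equations of motion and the equations for \<open>\<Gamma>2\<close> and \<open>\<Gamma>3\<close> on the
  time domain \<open>S\<close>; none of them involves the rotor angle or the torque.
\<close>

definition skate_rotor_free_eqs ::
  "real \<Rightarrow> real \<Rightarrow> real \<Rightarrow> real \<Rightarrow> real \<Rightarrow> real \<Rightarrow> real set
   \<Rightarrow> (real \<Rightarrow> real) \<Rightarrow> (real \<Rightarrow> real) \<Rightarrow> (real \<Rightarrow> real) \<Rightarrow> (real \<Rightarrow> real) \<Rightarrow> (real \<Rightarrow> real) \<Rightarrow> bool"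
where
  "skate_rotor_free_eqs m l I2 I3 J2 J3 S v1 v2 v3 \<Gamma>2 \<Gamma>3 \<longleftrightarrow> (\<forall>t\<in>S.
     ((\<lambda>s. (((I2 + J2) + m * l\<^sup>2) * (\<Gamma>2 s)\<^sup>2 + (I3 + J3) * (\<Gamma>3 s)\<^sup>2) * v2 s + m * l * \<Gamma>2 s * v3 s)
        has_real_derivative m * l * \<Gamma>3 t * v3 t * v1 t) (at t within S) \<and>
     ((\<lambda>s. m * (l * \<Gamma>2 s * v2 s + v3 s))
        has_real_derivative - (m * l * \<Gamma>3 t * v1 t * v2 t)) (at t within S) \<and>
     (\<Gamma>2 has_real_derivative v1 t * \<Gamma>3 t) (at t within S) \<and>
     (\<Gamma>3 has_real_derivative - (v1 t * \<Gamma>2 t)) (at t within S))"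

text \<open>
  Equations of motion of the pendulum skate with rotor angle \<open>\<theta>\<close> under the torque \<open>u\<close>;
  \<open>\<omega>\<close> is the time derivative of \<open>\<theta>\<close>.
\<close>

definition skate_rotor_motion ::
  "real \<Rightarrow> real \<Rightarrow> real \<Rightarrow> real \<Rightarrow> real \<Rightarrow> real \<Rightarrow> real \<Rightarrow> real \<Rightarrow> real \<Rightarrow> real set \<Rightarrow> (real \<Rightarrow> real)
   \<Rightarrow> (real \<Rightarrow> real) \<Rightarrow> (real \<Rightarrow> real) \<Rightarrow> (real \<Rightarrow> real) \<Rightarrow> (real \<Rightarrow> real) \<Rightarrow> (real \<Rightarrow> real)
   \<Rightarrow> (real \<Rightarrow> real) \<Rightarrow> bool"
where
  "skate_rotor_motion m l g I1 I2 I3 J1 J2 J3 S u v1 v2 v3 \<Gamma>2 \<Gamma>3 \<theta> \<longleftrightarrow>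
     (\<exists>\<omega>. \<forall>t\<in>S.
        (\<theta> has_real_derivative \<omega> t) (at t within S) \<and>
        ((\<lambda>s. ((I1 + J1) + m * l\<^sup>2) * v1 s + J1 * \<omega> s)
           has_real_derivative skate_force m l g I2 I3 J2 J3 (v1 t, v2 t, v3 t, \<Gamma>2 t, \<Gamma>3 t))
           (at t within S) \<and>
        ((\<lambda>s. J1 * (v1 s + \<omega> s)) has_real_derivative u t) (at t within S)) \<and>
     skate_rotor_free_eqs m l I2 I3 J2 J3 S v1 v2 v3 \<Gamma>2 \<Gamma>3"

text \<open>
  Solutions \<open>\<zeta> = (v1, v2, v3, \<Gamma>2, \<Gamma>3)\<close> of the controlled system, with the control law
  \<open>u = (J1\<^sup>2 / \<sigma>) a\<close>, where \<open>a\<close> is the time derivative of \<open>v1\<close>.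
\<close>

definition controlled_skate_solution ::
  "real \<Rightarrow> real \<Rightarrow> real \<Rightarrow> real \<Rightarrow> real \<Rightarrow> real \<Rightarrow> real \<Rightarrow> real \<Rightarrow> real \<Rightarrow> real \<Rightarrow> real set
   \<Rightarrow> (real \<Rightarrow> real \<times> real \<times> real \<times> real \<times> real) \<Rightarrow> bool"
where
  "controlled_skate_solution m l g I1 I2 I3 J1 J2 J3 \<sigma> S \<zeta> \<longleftrightarrow>
     \<zeta> differentiable_on S \<and>
     (\<exists>v1 v2 v3 \<Gamma>2 \<Gamma>3 \<theta> u a.
        \<zeta> = (\<lambda>t. (v1 t, v2 t, v3 t, \<Gamma>2 t, \<Gamma>3 t)) \<and>
        (\<forall>t\<in>S. (v1 has_real_derivative a t) (at t within S) \<and> u t = J1\<^sup>2 / \<sigma> * a t) \<and>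
        skate_rotor_motion m l g I1 I2 I3 J1 J2 J3 S u v1 v2 v3 \<Gamma>2 \<Gamma>3 \<theta>)"

text \<open>
  Eliminating the rotor: the curves \<open>\<zeta>\<close> above are exactly the solutions of the closed system
  in which the first equation becomes the one for the derivative of \<open>v1\<close> below.
\<close>

lemma controlled_skate_solution_iff_closed_system:
  assumes "\<sigma> \<noteq> 0" "T > 0"
  shows "controlled_skate_solution m l g I1 I2 I3 J1 J2 J3 \<sigma> {0..T} \<zeta> \<longleftrightarrow>
     \<zeta> differentiable_on {0..T} \<and>
     (\<exists>v1 v2 v3 \<Gamma>2 \<Gamma>3 a.
        \<zeta> = (\<lambda>t. (v1 t, v2 t, v3 t, \<Gamma>2 t, \<Gamma>3 t)) \<and>
        (\<forall>t\<in>{0..T}. (v1 has_real_derivative a t) (at t within {0..T}) \<and>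
           (I1 + m * l\<^sup>2 + J1\<^sup>2 / \<sigma>) * a t
             = skate_force m l g I2 I3 J2 J3 (v1 t, v2 t, v3 t, \<Gamma>2 t, \<Gamma>3 t)) \<and>
        skate_rotor_free_eqs m l I2 I3 J2 J3 {0..T} v1 v2 v3 \<Gamma>2 \<Gamma>3)"
    (is "?L \<longleftrightarrow> ?R")
proof
  assume ?L
  then obtain v1 v2 v3 \<Gamma>2 \<Gamma>3 \<theta> u a where
    d: "\<zeta> differentiable_on {0..T}" and
    z: "\<zeta> = (\<lambda>t. (v1 t, v2 t, v3 t, \<Gamma>2 t, \<Gamma>3 t))" and
    au: "\<forall>t\<in>{0..T}. (v1 has_real_derivative a t) (at t within {0..T})
      \<and> u t = J1\<^sup>2 / \<sigma> * a t" and
    M: "skate_rotor_motion m l g I1 I2 I3 J1 J2 J3 {0..T} u v1 v2 v3 \<Gamma>2 \<Gamma>3 \<theta>"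
    unfolding controlled_skate_solution_def by (elim conjE exE) (rule that)
  have a: "(v1 has_real_derivative a t) (at t within {0..T})"
    and u: "u t = J1\<^sup>2 / \<sigma> * a t"
    if "t \<in> {0..T}" for t
    using bspec[OF au that] by simp_all
  from M have r: "skate_rotor_free_eqs m l I2 I3 J2 J3 {0..T} v1 v2 v3 \<Gamma>2 \<Gamma>3"
    unfolding skate_rotor_motion_def by (rule conjunct2)
  from M obtain \<omega> where W: "\<forall>t\<in>{0..T}.
        (\<theta> has_real_derivative \<omega> t) (at t within {0..T}) \<and>
        ((\<lambda>s. ((I1 + J1) + m * l\<^sup>2) * v1 s + J1 * \<omega> s)
           has_real_derivative skate_force m l g I2 I3 J2 J3 (v1 t, v2 t, v3 t, \<Gamma>2 t, \<Gamma>3 t))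
           (at t within {0..T}) \<and>
        ((\<lambda>s. J1 * (v1 s + \<omega> s)) has_real_derivative u t) (at t within {0..T})"
    unfolding skate_rotor_motion_def by (elim conjE exE) (rule that)
  have e1: "((\<lambda>s. ((I1 + J1) + m * l\<^sup>2) * v1 s + J1 * \<omega> s)
           has_real_derivative skate_force m l g I2 I3 J2 J3 (v1 t, v2 t, v3 t, \<Gamma>2 t, \<Gamma>3 t))
           (at t within {0..T})"
    and e4: "((\<lambda>s. J1 * (v1 s + \<omega> s)) has_real_derivative u t) (at t within {0..T})"
    if "t \<in> {0..T}" for t
    using bspec[OF W that] by simp_all
  have "(I1 + m * l\<^sup>2 + J1\<^sup>2 / \<sigma>) * a t
      = skate_force m l g I2 I3 J2 J3 (v1 t, v2 t, v3 t, \<Gamma>2 t, \<Gamma>3 t)" if t: "t \<in> {0..T}" for t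
  proof -
    have "((\<lambda>s. (I1 + m * l\<^sup>2) * v1 s + J1 * (v1 s + \<omega> s)) has_real_derivative
        (I1 + m * l\<^sup>2) * a t + J1\<^sup>2 / \<sigma> * a t) (at t within {0..T})"
      using DERIV_add[OF DERIV_cmult[OF a[OF t], of "I1 + m * l\<^sup>2"] e4[OF t]] u[OF t] by simp
    moreover have "(\<lambda>s. (I1 + m * l\<^sup>2) * v1 s + J1 * (v1 s + \<omega> s))
        = (\<lambda>s. ((I1 + J1) + m * l\<^sup>2) * v1 s + J1 * \<omega> s)"
      by (auto simp: algebra_simps)
    ultimately have D: "((\<lambda>s. ((I1 + J1) + m * l\<^sup>2) * v1 s + J1 * \<omega> s) has_vector_derivative
        (I1 + m * l\<^sup>2) * a t + J1\<^sup>2 / \<sigma> * a t) (at t within {0..T})"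
      by (simp add: has_real_derivative_iff_has_vector_derivative)
    have "(I1 + m * l\<^sup>2) * a t + J1\<^sup>2 / \<sigma> * a t
        = skate_force m l g I2 I3 J2 J3 (v1 t, v2 t, v3 t, \<Gamma>2 t, \<Gamma>3 t)"
      using vector_derivative_unique_within_closed_interval[of 0 T t]
        D e1[OF t] t \<open>T > 0\<close>
      by (auto simp: has_real_derivative_iff_has_vector_derivative)
    then show ?thesis by (simp add: algebra_simps)
  qed
  with a have P: "\<forall>t\<in>{0..T}. (v1 has_real_derivative a t) (at t within {0..T}) \<and>
           (I1 + m * l\<^sup>2 + J1\<^sup>2 / \<sigma>) * a t
             = skate_force m l g I2 I3 J2 J3 (v1 t, v2 t, v3 t, \<Gamma>2 t, \<Gamma>3 t)"
    by simp
  show ?R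
    by (intro conjI d exI) (rule z, rule P, rule r)
next
  assume ?R
  then obtain v1 v2 v3 \<Gamma>2 \<Gamma>3 a where
    d: "\<zeta> differentiable_on {0..T}" and
    z: "\<zeta> = (\<lambda>t. (v1 t, v2 t, v3 t, \<Gamma>2 t, \<Gamma>3 t))" and
    ae: "\<forall>t\<in>{0..T}. (v1 has_real_derivative a t) (at t within {0..T}) \<and>
           (I1 + m * l\<^sup>2 + J1\<^sup>2 / \<sigma>) * a t
             = skate_force m l g I2 I3 J2 J3 (v1 t, v2 t, v3 t, \<Gamma>2 t, \<Gamma>3 t)" and
    r: "skate_rotor_free_eqs m l I2 I3 J2 J3 {0..T} v1 v2 v3 \<Gamma>2 \<Gamma>3"
    by (elim conjE exE) (rule that)
  have a: "(v1 has_real_derivative a t) (at t within {0..T})"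
    and e: "(I1 + m * l\<^sup>2 + J1\<^sup>2 / \<sigma>) * a t
        = skate_force m l g I2 I3 J2 J3 (v1 t, v2 t, v3 t, \<Gamma>2 t, \<Gamma>3 t)"
    if "t \<in> {0..T}" for t
    using bspec[OF ae that] by simp_all
  define \<omega> where "\<omega> = (\<lambda>t. (J1 / \<sigma> - 1) * v1 t)"
  define \<theta> where "\<theta> = (\<lambda>t. integral {0..t} \<omega>)"
  have "continuous_on {0..T} v1"
    using DERIV_continuous[OF a] by (simp add: continuous_on_eq_continuous_within)
  then have c: "continuous_on {0..T} \<omega>"
    unfolding \<omega>_def by (intro continuous_intros)
  have th: "(\<theta> has_real_derivative \<omega> t) (at t within {0..T})" if "t \<in> {0..T}" for t
    unfolding \<theta>_def using integral_has_real_derivative[OF c that] .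
  have eq1: "(\<lambda>s. ((I1 + J1) + m * l\<^sup>2) * v1 s + J1 * \<omega> s)
      = (\<lambda>s. (I1 + m * l\<^sup>2 + J1\<^sup>2 / \<sigma>) * v1 s)"
    by (auto simp: \<omega>_def algebra_simps power2_eq_square)
  have eq4: "(\<lambda>s. J1 * (v1 s + \<omega> s)) = (\<lambda>s. J1\<^sup>2 / \<sigma> * v1 s)"
    by (auto simp: \<omega>_def algebra_simps power2_eq_square)
  have M: "skate_rotor_motion m l g I1 I2 I3 J1 J2 J3 {0..T} (\<lambda>t. J1\<^sup>2 / \<sigma> * a t) v1 v2 v3 \<Gamma>2 \<Gamma>3 \<theta>"
    unfolding skate_rotor_motion_def
  proof (intro conjI exI[of _ \<omega>] ballI r th)
    fix t assume t: "t \<in> {0..T}"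
    show "((\<lambda>s. ((I1 + J1) + m * l\<^sup>2) * v1 s + J1 * \<omega> s)
       has_real_derivative skate_force m l g I2 I3 J2 J3 (v1 t, v2 t, v3 t, \<Gamma>2 t, \<Gamma>3 t))
       (at t within {0..T})"
      unfolding eq1 e[OF t, symmetric] by (rule DERIV_cmult[OF a[OF t]])
    show "((\<lambda>s. J1 * (v1 s + \<omega> s)) has_real_derivative J1\<^sup>2 / \<sigma> * a t) (at t within {0..T})"
      unfolding eq4 by (rule DERIV_cmult[OF a[OF t]])
  qed
  have P: "\<forall>t\<in>{0..T}. (v1 has_real_derivative a t) (at t within {0..T})
      \<and> J1\<^sup>2 / \<sigma> * a t = J1\<^sup>2 / \<sigma> * a t"
    using a by simp
  show ?L
    unfolding controlled_skate_solution_def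
    by (intro conjI d exI) (rule z, rule P, rule M)
qed

text \<open>
  Lyapunov stability of an equilibrium \<open>e\<close> of the system whose solutions on a time domain \<open>S\<close>
  are given by \<open>sol S\<close>. Solutions are quantified over all compact intervals \<open>[0, T]\<close>, so the
  bound holds on the whole interval of existence, whatever its length.
\<close>

definition equilibrium :: "(real set \<Rightarrow> (real \<Rightarrow> 'a) \<Rightarrow> bool) \<Rightarrow> 'a \<Rightarrow> bool" where
  "equilibrium sol e \<longleftrightarrow> (\<forall>T>0. sol {0..T} (\<lambda>t. e))"

definition lyapunov_stable ::
  "(real set \<Rightarrow> (real \<Rightarrow> 'a::metric_space) \<Rightarrow> bool) \<Rightarrow> 'a \<Rightarrow> bool"
where
  "lyapunov_stable sol e \<longleftrightarrow> equilibrium sol e \<and>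
     (\<forall>\<epsilon>>0. \<exists>\<delta>>0. \<forall>T>0. \<forall>x. sol {0..T} x \<and> dist (x 0) e < \<delta>
        \<longrightarrow> (\<forall>t\<in>{0..T}. dist (x t) e < \<epsilon>))"

end

theory Submission
  imports Defs
begin

text \<open>
  Write \<open>D = (I2 + J2) \<Gamma>2\<^sup>2 + (I3 + J3) \<Gamma>3\<^sup>2\<close> and \<open>w = l \<Gamma>2 v2 + v3\<close>. Then \<open>r\<^sup>2 = \<Gamma>2\<^sup>2 + \<Gamma>3\<^sup>2\<close> and
  \<open>c = D v2\<close> are constants of motion, and so is
  \<open>(A v1\<^sup>2 + c\<^sup>2 / D + m w\<^sup>2) / 2 + m g l \<Gamma>3\<close>, where \<open>A = I1 + m l\<^sup>2 + J1\<^sup>2 / \<sigma>\<close>.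
  Since \<open>w' = - l c \<Gamma>2' / D\<close> and \<open>D\<close> is a function of \<open>\<Gamma>2\<close> alone on the circle of radius \<open>r\<close>, the
  drift of \<open>w\<close> is of order \<open>c\<close>, uniformly in time. The condition on \<open>\<sigma>\<close> says \<open>A < 0\<close>, so
  \<open>-A v1\<^sup>2 / 2 + m g l (r - \<Gamma>3)\<close> is a sum of nonnegative terms. By conservation of energy it exceeds
  its initial value by at most the change of \<open>(c\<^sup>2 / D + m w\<^sup>2) / 2\<close>, which is small with \<open>c\<close>.
\<close>

section \<open>Stability criterion and calculus lemmas\<close>

text \<open>Once \<open>\<Phi> z < \<epsilon>\<close> near \<open>e\<close>, the same neighbourhood
  gives \<open>\<delta>\<close>. The bound is required only for initial states near
  \<open>e\<close>, because the estimates for the skate degenerate at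
  \<open>\<Gamma>2 = \<Gamma>3 = 0\<close>.\<close>

lemma lyapunov_stableI:
  fixes e :: "'a::metric_space" and \<Phi> :: "'a \<Rightarrow> real"
  assumes "equilibrium sol e"
    and lim: "(\<Phi> \<longlongrightarrow> 0) (nhds e)"
    and bound: "\<forall>\<^sub>F z in nhds e. \<forall>T>0. \<forall>x. sol {0..T} x \<longrightarrow> x 0 = z
      \<longrightarrow> (\<forall>t\<in>{0..T}. dist (x t) e \<le> \<Phi> z)"
  shows "lyapunov_stable sol e"
  unfolding lyapunov_stable_def
proof (intro conjI allI impI)
  fix \<epsilon> :: real assume "\<epsilon> > 0"
  then have "\<forall>\<^sub>F z in nhds e. \<Phi> z < \<epsilon>"
    using order_tendstoD(2)[OF lim] by blast
  with bound have "\<forall>\<^sub>F z in nhds e. \<forall>T>0. \<forall>x. sol {0..T} x \<longrightarrow> x 0 = z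
      \<longrightarrow> (\<forall>t\<in>{0..T}. dist (x t) e < \<epsilon>)"
    by eventually_elim force
  then show "\<exists>\<delta>>0. \<forall>T>0. \<forall>x. sol {0..T} x \<and> dist (x 0) e < \<delta>
      \<longrightarrow> (\<forall>t\<in>{0..T}. dist (x t) e < \<epsilon>)"
    unfolding eventually_nhds_metric by blast
qed fact

lemma constant_of_zero_real_derivative:
  fixes f :: "real \<Rightarrow> real"
  assumes "\<And>t. t \<in> {0..T} \<Longrightarrow> (f has_real_derivative 0) (at t within {0..T})"
    and "t \<in> {0..T}"
  shows "f t = f 0"
proof -
  obtain c where "\<forall>s\<in>{0..T}. f s = c"
    using has_field_derivative_zero_constant[of "{0..T}" f] assms(1) by auto
  with assms(2) show ?thesis by auto
qed

text \<open>With an antiderivative \<open>F\<close> of \<open>f\<close>, the difference of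
  \<open>w\<close> and \<open>F \<circ> x\<close> is constant. Hence the change of \<open>w\<close>
  depends only on the endpoints of \<open>x\<close>, however long or oscillating the path between
  them, and the bound is free of \<open>T\<close>.\<close>

lemma drift_bound_of_autonomous_rate:
  fixes w x f :: "real \<Rightarrow> real"
  assumes w: "\<And>t. t \<in> {0..T} \<Longrightarrow> (w has_real_derivative f (x t) * x' t) (at t within {0..T})"
    and x: "\<And>t. t \<in> {0..T} \<Longrightarrow> (x has_real_derivative x' t) (at t within {0..T})"
    and range: "\<And>t. t \<in> {0..T} \<Longrightarrow> x t \<in> {a..b}"
    and cont: "continuous_on {a..b} f"
    and bound: "\<And>y. y \<in> {a..b} \<Longrightarrow> \<bar>f y\<bar> \<le> M"
    and t: "t \<in> {0..T}"
  shows "\<bar>w t - w 0\<bar> \<le> M * (b - a)"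
proof -
  obtain F where F: "\<And>y. y \<in> {a..b} \<Longrightarrow> (F has_real_derivative f y) (at y within {a..b})"
    using antiderivative_continuous[OF cont]
    by (auto simp: has_real_derivative_iff_has_vector_derivative)
  have "((\<lambda>s. w s - F (x s)) has_real_derivative 0) (at s within {0..T})" if s: "s \<in> {0..T}" for s
  proof -
    \<comment> \<open>\<open>F\<close> is differentiable only relative to \<open>{a..b}\<close>, so
      the chain rule is applied within the image of \<open>x\<close>.\<close>
    have "(F has_real_derivative f (x s)) (at (x s) within x ` {0..T})"
      by (rule DERIV_subset[OF F[OF range[OF s]]]) (use range in blast)
    then have "((\<lambda>s. F (x s)) has_real_derivative f (x s) * x' s) (at s within {0..T})"
      using DERIV_image_chain[of F "f (x s)" x s "{0..T}" "x' s"] x[OF s] by (simp add: o_def)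
    from DERIV_diff[OF w[OF s] this] show ?thesis by simp
  qed
  from constant_of_zero_real_derivative[OF this t]
  have "w t - w 0 = F (x t) - F (x 0)" by simp
  also have "norm (F (x t) - F (x 0)) \<le> M * norm (x t - x 0)"
    by (rule field_differentiable_bound[of "{a..b}" F f])
      (use F bound range t in auto)
  also have "\<dots> \<le> M * (b - a)"
  proof (rule mult_left_mono)
    show "norm (x t - x 0) \<le> b - a" using range[OF t] range[of 0] t by auto
    show "0 \<le> M" using bound[OF range[OF t]] by linarith
  qed
  finally show ?thesis by simp
qed

section \<open>Conservation laws of the closed system, with \<open>B2\<close>, \<open>B3\<close> for
  \<open>I2 + J2\<close>, \<open>I3 + J3\<close>\<close>

context
  fixes m l g A B2 B3 T :: real and v1 v2 v3 \<Gamma>2 \<Gamma>3 a :: "real \<Rightarrow> real"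
  assumes pos: "m > 0" "l > 0" "g > 0" "B2 > 0" "B3 > 0" "A < 0"
    and d1: "\<And>t. t \<in> {0..T} \<Longrightarrow> (v1 has_real_derivative a t) (at t within {0..T})"
    and e1: "\<And>t. t \<in> {0..T} \<Longrightarrow> A * a t =
      (B2 + m * l\<^sup>2 - B3) * \<Gamma>2 t * \<Gamma>3 t * (v2 t)\<^sup>2 + m * l * \<Gamma>3 t * v2 t * v3 t + m * g * l * \<Gamma>2 t"
    and d2: "\<And>t. t \<in> {0..T} \<Longrightarrow>
      ((\<lambda>s. ((B2 + m * l\<^sup>2) * (\<Gamma>2 s)\<^sup>2 + B3 * (\<Gamma>3 s)\<^sup>2) * v2 s + m * l * \<Gamma>2 s * v3 s)
        has_real_derivative m * l * \<Gamma>3 t * v3 t * v1 t) (at t within {0..T})"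
    and d3: "\<And>t. t \<in> {0..T} \<Longrightarrow>
      ((\<lambda>s. m * (l * \<Gamma>2 s * v2 s + v3 s))
        has_real_derivative - (m * l * \<Gamma>3 t * v1 t * v2 t)) (at t within {0..T})"
    and dG2: "\<And>t. t \<in> {0..T} \<Longrightarrow> (\<Gamma>2 has_real_derivative v1 t * \<Gamma>3 t) (at t within {0..T})"
    and dG3: "\<And>t. t \<in> {0..T} \<Longrightarrow> (\<Gamma>3 has_real_derivative - (v1 t * \<Gamma>2 t)) (at t within {0..T})"
begin

lemma vertical_norm_conserved:
  assumes "t \<in> {0..T}"
  shows "(\<Gamma>2 t)\<^sup>2 + (\<Gamma>3 t)\<^sup>2 = (\<Gamma>2 0)\<^sup>2 + (\<Gamma>3 0)\<^sup>2"
  by (rule constant_of_zero_real_derivative[OF _ assms])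
    (auto intro!: derivative_eq_intros dG2 dG3)

text \<open>Subtracting \<open>l * \<Gamma>2\<close> times the momentum of the third equation from
  that of the second removes \<open>v3\<close>, and the product rule makes the right-hand sides
  cancel as well.\<close>

lemma yaw_momentum_conserved:
  assumes t: "t \<in> {0..T}"
  shows "(B2 * (\<Gamma>2 t)\<^sup>2 + B3 * (\<Gamma>3 t)\<^sup>2) * v2 t = (B2 * (\<Gamma>2 0)\<^sup>2 + B3 * (\<Gamma>3 0)\<^sup>2) * v2 0"
proof (rule constant_of_zero_real_derivative[OF _ t])
  fix s assume s: "s \<in> {0..T}"
  have eq: "(\<lambda>s. (B2 * (\<Gamma>2 s)\<^sup>2 + B3 * (\<Gamma>3 s)\<^sup>2) * v2 s) =
     (\<lambda>s. (((B2 + m * l\<^sup>2) * (\<Gamma>2 s)\<^sup>2 + B3 * (\<Gamma>3 s)\<^sup>2) * v2 s + m * l * \<Gamma>2 s * v3 s)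
        - l * \<Gamma>2 s * (m * (l * \<Gamma>2 s * v2 s + v3 s)))"
    by (auto simp: algebra_simps power2_eq_square)
  show "((\<lambda>s. (B2 * (\<Gamma>2 s)\<^sup>2 + B3 * (\<Gamma>3 s)\<^sup>2) * v2 s) has_real_derivative 0) (at s within {0..T})"
    unfolding eq
    by (rule DERIV_cong[OF DERIV_diff[OF d2[OF s] DERIV_mult[OF DERIV_cmult[OF dG2[OF s]] d3[OF s]]]])
      (simp add: algebra_simps power2_eq_square)
qed

lemma slip_velocity_derivative:
  assumes "t \<in> {0..T}"
  shows "((\<lambda>s. l * \<Gamma>2 s * v2 s + v3 s) has_real_derivative - (l * \<Gamma>3 t * v1 t * v2 t))
    (at t within {0..T})"
  using DERIV_cdivide[OF d3[OF assms], of m] pos(1) by (simp add: mult.assoc)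

lemma inertia_lower_bound:
  "min B2 B3 * (x\<^sup>2 + y\<^sup>2) \<le> B2 * x\<^sup>2 + B3 * y\<^sup>2"
  by (simp add: distrib_left add_mono mult_right_mono)

lemma inertia_pos:
  fixes x y :: real
  assumes "x\<^sup>2 + y\<^sup>2 > 0"
  shows "B2 * x\<^sup>2 + B3 * y\<^sup>2 > 0"
proof -
  have "0 < min B2 B3 * (x\<^sup>2 + y\<^sup>2)" using pos assms by simp
  also note inertia_lower_bound
  finally show ?thesis .
qed

section \<open>Estimates along a motion with vertical norm \<open>r\<close> and yaw momentum
  \<open>c\<close>\<close>

context
  fixes r c :: real
  assumes r: "r > 0" "(\<Gamma>2 0)\<^sup>2 + (\<Gamma>3 0)\<^sup>2 = r\<^sup>2"
    and c: "c = (B2 * (\<Gamma>2 0)\<^sup>2 + B3 * (\<Gamma>3 0)\<^sup>2) * v2 0"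
begin

lemma on_circle: "t \<in> {0..T} \<Longrightarrow> (\<Gamma>2 t)\<^sup>2 + (\<Gamma>3 t)\<^sup>2 = r\<^sup>2"
  using vertical_norm_conserved r by simp

lemma inertia_along_motion:
  assumes t: "t \<in> {0..T}"
  shows "min B2 B3 * r\<^sup>2 \<le> B2 * (\<Gamma>2 t)\<^sup>2 + B3 * (\<Gamma>3 t)\<^sup>2" "B2 * (\<Gamma>2 t)\<^sup>2 + B3 * (\<Gamma>3 t)\<^sup>2 > 0"
  using inertia_lower_bound[of "\<Gamma>2 t" "\<Gamma>3 t"] inertia_pos[of "\<Gamma>2 t" "\<Gamma>3 t"] on_circle[OF t] r
  by auto

lemma yaw_rate:
  assumes t: "t \<in> {0..T}"
  shows "v2 t = c / (B2 * (\<Gamma>2 t)\<^sup>2 + B3 * (\<Gamma>3 t)\<^sup>2)"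
  using yaw_momentum_conserved[OF t] inertia_along_motion(2)[OF t] c by (simp add: field_simps)

lemma yaw_rate_bound:
  assumes t: "t \<in> {0..T}"
  shows "\<bar>v2 t\<bar> \<le> \<bar>c\<bar> / (min B2 B3 * r\<^sup>2)"
  unfolding yaw_rate[OF t] abs_divide
  by (rule divide_left_mono) (use inertia_along_motion[OF t] pos r in auto)

lemma vertical_component_bounds:
  assumes t: "t \<in> {0..T}"
  shows "\<bar>\<Gamma>2 t\<bar> \<le> r" "\<bar>\<Gamma>3 t\<bar> \<le> r"
proof -
  have "(\<Gamma>2 t)\<^sup>2 \<le> r\<^sup>2" "(\<Gamma>3 t)\<^sup>2 \<le> r\<^sup>2" using on_circle[OF t] by (smt (verit) zero_le_power2)+
  then show "\<bar>\<Gamma>2 t\<bar> \<le> r" "\<bar>\<Gamma>3 t\<bar> \<le> r" using r by (simp_all flip: abs_le_square_iff)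
qed

text \<open>The factor \<open>2 * r\<close> is the length of the interval \<open>{-r..r}\<close> in
  which \<open>\<Gamma>2\<close> moves; the other factor bounds the rate of the slip velocity with
  respect to \<open>\<Gamma>2\<close>.\<close>

lemma slip_velocity_drift:
  assumes t: "t \<in> {0..T}"
  shows "\<bar>(l * \<Gamma>2 t * v2 t + v3 t) - (l * \<Gamma>2 0 * v2 0 + v3 0)\<bar>
    \<le> l * \<bar>c\<bar> / (min B2 B3 * r\<^sup>2) * (2 * r)"
proof -
  \<comment> \<open>The circle relation eliminates \<open>\<Gamma>3\<close>, which makes the rate a
    function of \<open>\<Gamma>2\<close> alone.\<close>
  define D where "D = (\<lambda>x. B2 * x\<^sup>2 + B3 * (r\<^sup>2 - x\<^sup>2))"
  have D_lower: "min B2 B3 * r\<^sup>2 \<le> D x" if "x \<in> {-r..r}" for x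
  proof -
    have "x\<^sup>2 \<le> r\<^sup>2" using that r by (simp add: abs_le_square_iff[symmetric] abs_le_iff)
    \<comment> \<open>The square root stands for \<open>\<bar>\<Gamma>3\<bar>\<close> at the point
      of the circle with \<open>\<Gamma>2 = x\<close>.\<close>
    then show ?thesis
      using inertia_lower_bound[of x "sqrt (r\<^sup>2 - x\<^sup>2)"] by (simp add: D_def)
  qed
  have m_pos: "min B2 B3 * r\<^sup>2 > 0" using pos r by simp
  have D_motion: "D (\<Gamma>2 s) = B2 * (\<Gamma>2 s)\<^sup>2 + B3 * (\<Gamma>3 s)\<^sup>2" if "s \<in> {0..T}" for s
    by (simp add: D_def on_circle[OF that, symmetric])
  have "\<bar>(l * \<Gamma>2 t * v2 t + v3 t) - (l * \<Gamma>2 0 * v2 0 + v3 0)\<bar>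
    \<le> l * \<bar>c\<bar> / (min B2 B3 * r\<^sup>2) * (r - (-r))"
  proof (rule drift_bound_of_autonomous_rate[where f = "\<lambda>x. - (l * c) / D x" and x = \<Gamma>2
        and x' = "\<lambda>s. v1 s * \<Gamma>3 s" and w = "\<lambda>s. l * \<Gamma>2 s * v2 s + v3 s", OF _ dG2 _ _ _ t])
    fix s assume s: "s \<in> {0..T}"
    show "((\<lambda>s. l * \<Gamma>2 s * v2 s + v3 s) has_real_derivative
        - (l * c) / D (\<Gamma>2 s) * (v1 s * \<Gamma>3 s)) (at s within {0..T})"
      by (rule DERIV_cong[OF slip_velocity_derivative[OF s]])
        (simp add: yaw_rate[OF s] D_motion[OF s])
    show "\<Gamma>2 s \<in> {-r..r}" using vertical_component_bounds[OF s] by auto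
  next
    show "continuous_on {-r..r} (\<lambda>x. - (l * c) / D x)"
      using D_lower m_pos unfolding D_def by (intro continuous_intros) force
  next
    fix x assume x: "x \<in> {-r..r}"
    show "\<bar>- (l * c) / D x\<bar> \<le> l * \<bar>c\<bar> / (min B2 B3 * r\<^sup>2)"
      using D_lower[OF x] m_pos pos by (auto simp: abs_mult intro!: divide_left_mono)
  qed auto
  then show ?thesis by simp
qed

text \<open>Since \<open>c = D v2\<close>, this is the energy of the skate with \<open>A\<close> as
  the inertia belonging to \<open>v1\<close>. In this form the yaw part varies only through
  \<open>D\<close>.\<close>

lemma energy_conserved:
  assumes t: "t \<in> {0..T}"
  defines "E \<equiv> \<lambda>s. (A * (v1 s)\<^sup>2 + c\<^sup>2 / (B2 * (\<Gamma>2 s)\<^sup>2 + B3 * (\<Gamma>3 s)\<^sup>2)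
      + m * (l * \<Gamma>2 s * v2 s + v3 s)\<^sup>2) / 2 + m * g * l * \<Gamma>3 s"
  shows "E t = E 0"
  unfolding E_def
proof (rule constant_of_zero_real_derivative[OF _ t])
  fix s assume s: "s \<in> {0..T}"
  define D where "D = (\<lambda>s. B2 * (\<Gamma>2 s)\<^sup>2 + B3 * (\<Gamma>3 s)\<^sup>2)"
  define w where "w = (\<lambda>s. l * \<Gamma>2 s * v2 s + v3 s)"
  have D_pos: "D s > 0" using inertia_along_motion(2)[OF s] by (simp add: D_def)
  have cD: "c = D s * v2 s" using yaw_rate[OF s] D_pos by (simp add: D_def)
  have dD: "(D has_real_derivative 2 * (B2 - B3) * \<Gamma>2 s * \<Gamma>3 s * v1 s) (at s within {0..T})"
    unfolding D_def
    by (auto intro!: derivative_eq_intros dG2[OF s] dG3[OF s] simp: algebra_simps)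
  have dw: "(w has_real_derivative - (l * \<Gamma>3 s * v1 s * v2 s)) (at s within {0..T})"
    unfolding w_def by (rule slip_velocity_derivative[OF s])
  have dc: "((\<lambda>s. c\<^sup>2 / D s) has_real_derivative - (v2 s)\<^sup>2 * (2 * (B2 - B3) * \<Gamma>2 s * \<Gamma>3 s * v1 s))
      (at s within {0..T})"
    by (rule DERIV_cong[OF DERIV_divide[OF DERIV_const dD]])
      (use D_pos in \<open>simp_all add: cD power2_eq_square\<close>)
  have "((\<lambda>s. (A * (v1 s)\<^sup>2 + c\<^sup>2 / D s + m * (w s)\<^sup>2) / 2 + m * g * l * \<Gamma>3 s) has_real_derivative
      v1 s * (A * a s) - (v2 s)\<^sup>2 * ((B2 - B3) * \<Gamma>2 s * \<Gamma>3 s * v1 s)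
        - m * w s * (l * \<Gamma>3 s * v1 s * v2 s) - m * g * l * (v1 s * \<Gamma>2 s)) (at s within {0..T})"
    by (rule DERIV_cong[OF DERIV_add[OF DERIV_cdivide[OF DERIV_add[OF DERIV_add[OF
          DERIV_cmult[OF DERIV_power[OF d1[OF s]]] dc] DERIV_cmult[OF DERIV_power[OF dw]]]]
          DERIV_cmult[OF dG3[OF s]]]])
      (simp add: field_simps)
  \<comment> \<open>After \<open>e1\<close> is inserted, the \<open>B2 - B3\<close> terms cancel
    against the yaw term, the gravity terms against each other, and the remaining terms against the
    one with \<open>w\<close>.\<close>
  moreover have "v1 s * (A * a s) - (v2 s)\<^sup>2 * ((B2 - B3) * \<Gamma>2 s * \<Gamma>3 s * v1 s)
        - m * w s * (l * \<Gamma>3 s * v1 s * v2 s) - m * g * l * (v1 s * \<Gamma>2 s) = 0"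
    unfolding e1[OF s] w_def by (simp add: algebra_simps power2_eq_square)
  ultimately show "((\<lambda>s. (A * (v1 s)\<^sup>2 + c\<^sup>2 / (B2 * (\<Gamma>2 s)\<^sup>2 + B3 * (\<Gamma>3 s)\<^sup>2)
      + m * (l * \<Gamma>2 s * v2 s + v3 s)\<^sup>2) / 2 + m * g * l * \<Gamma>3 s) has_real_derivative 0)
      (at s within {0..T})"
    by (simp add: D_def w_def)
qed

text \<open>In the energy balance the yaw term at time \<open>t\<close> is bounded through the least
  inertia, and the initial one is dropped as nonnegative. The slip velocity need not be small, only
  its drift: the difference of the squares of \<open>w\<close> and \<open>w0\<close> factors as
  \<open>(w - w0) * (2 * w0 + (w - w0))\<close>, which carries a factor bounded by
  \<open>\<eta>\<close>.\<close>

lemma tilt_energy_bound: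
  assumes t: "t \<in> {0..T}"
  defines "w0 \<equiv> l * \<Gamma>2 0 * v2 0 + v3 0"
    and "\<eta> \<equiv> l * \<bar>c\<bar> / (min B2 B3 * r\<^sup>2) * (2 * r)"
  shows "- A * (v1 t)\<^sup>2 / 2 + m * g * l * (r - \<Gamma>3 t)
    \<le> - A * (v1 0)\<^sup>2 / 2 + m * g * l * (r - \<Gamma>3 0)
      + c\<^sup>2 / (min B2 B3 * r\<^sup>2) / 2 + m * (\<eta> * (2 * \<bar>w0\<bar> + \<eta>)) / 2"
proof -
  define w where "w = l * \<Gamma>2 t * v2 t + v3 t"
  have drift: "\<bar>w - w0\<bar> \<le> \<eta>"
    unfolding w_def w0_def \<eta>_def by (rule slip_velocity_drift[OF t])
  have "w\<^sup>2 - w0\<^sup>2 = (w - w0) * (2 * w0 + (w - w0))"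
    by (simp add: algebra_simps power2_eq_square)
  also have "\<dots> \<le> \<bar>w - w0\<bar> * \<bar>2 * w0 + (w - w0)\<bar>"
    by (metis abs_ge_self abs_mult)
  also have "\<dots> \<le> \<eta> * (2 * \<bar>w0\<bar> + \<eta>)"
    using drift by (intro mult_mono) auto
  finally have "m * (w\<^sup>2 - w0\<^sup>2) \<le> m * (\<eta> * (2 * \<bar>w0\<bar> + \<eta>))"
    using pos by (intro mult_left_mono) auto
  moreover have "c\<^sup>2 / (B2 * (\<Gamma>2 t)\<^sup>2 + B3 * (\<Gamma>3 t)\<^sup>2) \<le> c\<^sup>2 / (min B2 B3 * r\<^sup>2)"
    using inertia_along_motion[OF t] pos r by (intro divide_left_mono) auto
  moreover have "0 \<le> c\<^sup>2 / (B2 * (\<Gamma>2 0)\<^sup>2 + B3 * (\<Gamma>3 0)\<^sup>2)"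
    using inertia_along_motion(2)[of 0] t by (intro divide_nonneg_nonneg) auto
  ultimately show ?thesis
    using energy_conserved[OF t] unfolding w_def[symmetric] w0_def[symmetric]
    by (simp add: field_simps)
qed

end

end

section \<open>Explicit orbit bound in terms of the initial state\<close>

text \<open>The right-hand side of \<open>tilt_energy_bound\<close>, read as a function of the
  initial state alone so that its limit at the equilibrium can be taken.\<close>

definition skate_tilt_energy_bound ::
  "real \<Rightarrow> real \<Rightarrow> real \<Rightarrow> real \<Rightarrow> real \<Rightarrow> real \<Rightarrow> real \<times> real \<times> real \<times> real \<times> real \<Rightarrow> real"
where
  "skate_tilt_energy_bound m l g A B2 B3 = (\<lambda>(p, q, s, x, y).
     let r = sqrt (x\<^sup>2 + y\<^sup>2); c = (B2 * x\<^sup>2 + B3 * y\<^sup>2) * q;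
         \<eta> = l * \<bar>c\<bar> / (min B2 B3 * r\<^sup>2) * (2 * r)
     in - A * p\<^sup>2 / 2 + m * g * l * (r - y) + c\<^sup>2 / (min B2 B3 * r\<^sup>2) / 2
       + m * (\<eta> * (2 * \<bar>l * x * q + s\<bar> + \<eta>)) / 2)"

text \<open>
  The five summands bound \<open>\<bar>v1\<bar>\<close>, \<open>\<bar>v2\<bar>\<close>, \<open>\<bar>v3 - Y\<bar>\<close>, \<open>\<bar>\<Gamma>2\<bar>\<close> and \<open>\<bar>\<Gamma>3 - 1\<bar>\<close> along the orbit of the
  initial state. The bound on \<open>\<Gamma>2\<close> comes from \<open>\<Gamma>2\<^sup>2 = (r - \<Gamma>3) (r + \<Gamma>3) \<le> 2 r (r - \<Gamma>3)\<close>.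
\<close>

definition skate_orbit_bound ::
  "real \<Rightarrow> real \<Rightarrow> real \<Rightarrow> real \<Rightarrow> real \<Rightarrow> real \<Rightarrow> real \<Rightarrow> real \<times> real \<times> real \<times> real \<times> real \<Rightarrow> real"
where
  "skate_orbit_bound m l g A B2 B3 Y = (\<lambda>(p, q, s, x, y).
     let r = sqrt (x\<^sup>2 + y\<^sup>2); c = (B2 * x\<^sup>2 + B3 * y\<^sup>2) * q;
         \<kappa> = \<bar>c\<bar> / (min B2 B3 * r\<^sup>2);
         V = skate_tilt_energy_bound m l g A B2 B3 (p, q, s, x, y)
     in sqrt (2 * V / - A) + \<kappa> + (\<bar>l * x * q + s - Y\<bar> + l * \<bar>c\<bar> / (min B2 B3 * r\<^sup>2) * (2 * r) + l * r * \<kappa>)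
       + sqrt (2 * r * V / (m * g * l)) + (\<bar>r - 1\<bar> + V / (m * g * l)))"

text \<open>At the equilibrium \<open>r = 1\<close> and \<open>c = 0\<close>, so no denominator
  vanishes and every summand is continuous there with value 0.\<close>

lemma skate_orbit_bound_tendsto:
  assumes "m > 0" "l > 0" "g > 0" "B2 > 0" "B3 > 0" "A < 0"
  shows "(skate_orbit_bound m l g A B2 B3 Y \<longlongrightarrow> 0) (nhds (0, 0, Y, 0, 1))"
proof -
  have "isCont (skate_orbit_bound m l g A B2 B3 Y) (0, 0, Y, 0, 1)"
    unfolding skate_orbit_bound_def skate_tilt_energy_bound_def Let_def case_prod_unfold
    using assms by (intro continuous_intros) auto
  moreover have "skate_orbit_bound m l g A B2 B3 Y (0, 0, Y, 0, 1) = 0"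
    by (simp add: skate_orbit_bound_def skate_tilt_energy_bound_def)
  ultimately show ?thesis
    unfolding isCont_def tendsto_at_iff_tendsto_nhds by simp
qed

lemma dist_quintuple_le:
  fixes p q s x y p' q' s' x' y' :: real
  shows "dist (p, q, s, x, y) (p', q', s', x', y')
    \<le> \<bar>p - p'\<bar> + \<bar>q - q'\<bar> + \<bar>s - s'\<bar> + \<bar>x - x'\<bar> + \<bar>y - y'\<bar>"
proof -
  have pair: "dist (u, z) (u', z') \<le> dist u u' + dist z z'" for u u' :: real and z z' :: "'a::metric_space"
    by (simp add: dist_Pair_Pair sqrt_sum_squares_le_sum)
  show ?thesis
    using pair[of p "(q, s, x, y)" p' "(q', s', x', y')"] pair[of q "(s, x, y)" q' "(s', x', y')"]
      pair[of s "(x, y)" s' "(x', y')"] pair[of x y x' y']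
    by (simp add: dist_real_def)
qed

text \<open>Both terms of the tilt energy are nonnegative, as \<open>A < 0\<close> and
  \<open>\<Gamma>3 \<le> r\<close>, so each is at most \<open>V\<close>; this controls
  \<open>v1\<close> and \<open>r - \<Gamma>3\<close>. Conservation of \<open>c\<close> controls
  \<open>v2\<close>, and the drift estimate then gives \<open>v3\<close>. The initial vertical
  vector need only be nonzero, so perturbations off the unit circle are covered.\<close>

lemma skate_orbit_bound:
  fixes v1 v2 v3 \<Gamma>2 \<Gamma>3 a :: "real \<Rightarrow> real"
  assumes pos: "m > 0" "l > 0" "g > 0" "I2 + J2 > 0" "I3 + J3 > 0" "A < 0"
    and v1: "\<forall>t\<in>{0..T}. (v1 has_real_derivative a t) (at t within {0..T}) \<and>
      A * a t = skate_force m l g I2 I3 J2 J3 (v1 t, v2 t, v3 t, \<Gamma>2 t, \<Gamma>3 t)"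
    and free: "skate_rotor_free_eqs m l I2 I3 J2 J3 {0..T} v1 v2 v3 \<Gamma>2 \<Gamma>3"
    and nz: "(\<Gamma>2 0, \<Gamma>3 0) \<noteq> (0, 0)"
    and t: "t \<in> {0..T}"
  shows "dist (v1 t, v2 t, v3 t, \<Gamma>2 t, \<Gamma>3 t) (0, 0, Y, 0, 1)
    \<le> skate_orbit_bound m l g A (I2 + J2) (I3 + J3) Y (v1 0, v2 0, v3 0, \<Gamma>2 0, \<Gamma>3 0)"
proof -
  define B2 B3 where "B2 = I2 + J2" and "B3 = I3 + J3"
  define r where "r = sqrt ((\<Gamma>2 0)\<^sup>2 + (\<Gamma>3 0)\<^sup>2)"
  define c where "c = (B2 * (\<Gamma>2 0)\<^sup>2 + B3 * (\<Gamma>3 0)\<^sup>2) * v2 0"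
  define w0 where "w0 = l * \<Gamma>2 0 * v2 0 + v3 0"
  define \<kappa> where "\<kappa> = \<bar>c\<bar> / (min B2 B3 * r\<^sup>2)"
  define \<eta> where "\<eta> = l * \<bar>c\<bar> / (min B2 B3 * r\<^sup>2) * (2 * r)"
  define V where "V = skate_tilt_energy_bound m l g A B2 B3 (v1 0, v2 0, v3 0, \<Gamma>2 0, \<Gamma>3 0)"
  have r_pos: "r > 0" using nz by (auto simp: r_def sum_power2_gt_zero_iff)
  have r_sq: "(\<Gamma>2 0)\<^sup>2 + (\<Gamma>3 0)\<^sup>2 = r\<^sup>2" by (simp add: r_def)
  have pos': "B2 > 0" "B3 > 0" using pos by (simp_all add: B2_def B3_def)
  note v1 = v1[unfolded skate_force_def prod.case, folded B2_def B3_def]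
  note free = free[unfolded skate_rotor_free_eqs_def, folded B2_def B3_def]
  have d1: "\<And>t. t \<in> {0..T} \<Longrightarrow> (v1 has_real_derivative a t) (at t within {0..T})"
    and e1: "\<And>t. t \<in> {0..T} \<Longrightarrow> A * a t =
      (B2 + m * l\<^sup>2 - B3) * \<Gamma>2 t * \<Gamma>3 t * (v2 t)\<^sup>2 + m * l * \<Gamma>3 t * v2 t * v3 t + m * g * l * \<Gamma>2 t"
    using v1 by blast+
  have d2: "\<And>t. t \<in> {0..T} \<Longrightarrow>
      ((\<lambda>s. ((B2 + m * l\<^sup>2) * (\<Gamma>2 s)\<^sup>2 + B3 * (\<Gamma>3 s)\<^sup>2) * v2 s + m * l * \<Gamma>2 s * v3 s)
        has_real_derivative m * l * \<Gamma>3 t * v3 t * v1 t) (at t within {0..T})"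
    and d3: "\<And>t. t \<in> {0..T} \<Longrightarrow>
      ((\<lambda>s. m * (l * \<Gamma>2 s * v2 s + v3 s))
        has_real_derivative - (m * l * \<Gamma>3 t * v1 t * v2 t)) (at t within {0..T})"
    and dG2: "\<And>t. t \<in> {0..T} \<Longrightarrow> (\<Gamma>2 has_real_derivative v1 t * \<Gamma>3 t) (at t within {0..T})"
    and dG3: "\<And>t. t \<in> {0..T} \<Longrightarrow> (\<Gamma>3 has_real_derivative - (v1 t * \<Gamma>2 t)) (at t within {0..T})"
    using free by blast+
  note hyps = pos(1-3) pos' pos(6) d1 e1 d2 d3 dG2 dG3
  have circle: "(\<Gamma>2 t)\<^sup>2 + (\<Gamma>3 t)\<^sup>2 = r\<^sup>2"
    and G2: "\<bar>\<Gamma>2 t\<bar> \<le> r" and G3: "\<bar>\<Gamma>3 t\<bar> \<le> r"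
    and v2: "\<bar>v2 t\<bar> \<le> \<kappa>"
    and drift: "\<bar>l * \<Gamma>2 t * v2 t + v3 t - w0\<bar> \<le> \<eta>"
    and "- A * (v1 t)\<^sup>2 / 2 + m * g * l * (r - \<Gamma>3 t)
    \<le> - A * (v1 0)\<^sup>2 / 2 + m * g * l * (r - \<Gamma>3 0)
      + c\<^sup>2 / (min B2 B3 * r\<^sup>2) / 2 + m * (\<eta> * (2 * \<bar>w0\<bar> + \<eta>)) / 2"
    using on_circle[OF hyps r_pos r_sq c_def t] vertical_component_bounds[OF hyps r_pos r_sq c_def t]
      yaw_rate_bound[OF hyps r_pos r_sq c_def t] slip_velocity_drift[OF hyps r_pos r_sq c_def t]
      tilt_energy_bound[OF hyps r_pos r_sq c_def t]
    unfolding \<kappa>_def \<eta>_def w0_def by simp_all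
  then have tilt: "- A * (v1 t)\<^sup>2 / 2 + m * g * l * (r - \<Gamma>3 t) \<le> V"
    by (simp add: V_def skate_tilt_energy_bound_def Let_def r_def c_def \<eta>_def w0_def)
  have mgl: "m * g * l > 0" using pos by simp
  have "0 \<le> m * g * l * (r - \<Gamma>3 t)" by (rule mult_nonneg_nonneg) (use mgl G3 in auto)
  then have "- A * (v1 t)\<^sup>2 / 2 \<le> V" using tilt by linarith
  then have "(v1 t)\<^sup>2 \<le> 2 * V / - A" using pos(6) by (simp add: field_simps)
  then have b1: "\<bar>v1 t\<bar> \<le> sqrt (2 * V / - A)" by (intro real_le_rsqrt) simp
  have "0 \<le> - A * (v1 t)\<^sup>2 / 2" using pos(6) by (simp add: mult_nonpos_nonneg)
  then have "m * g * l * (r - \<Gamma>3 t) \<le> V" using tilt by linarith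
  then have gap: "r - \<Gamma>3 t \<le> V / (m * g * l)"
    using mgl by (simp add: pos_le_divide_eq mult.commute)
  \<comment> \<open>Here \<open>\<Gamma>3 - 1\<close> is \<open>(r - 1) - (r - \<Gamma>3)\<close>,
    and the gap \<open>r - \<Gamma>3\<close> lies between 0 and its bound.\<close>
  have b5: "\<bar>\<Gamma>3 t - 1\<bar> \<le> \<bar>r - 1\<bar> + V / (m * g * l)" using gap G3 by linarith
  have "(\<Gamma>2 t)\<^sup>2 = (r - \<Gamma>3 t) * (r + \<Gamma>3 t)"
    using circle by (simp add: algebra_simps power2_eq_square)
  also have "\<dots> \<le> V / (m * g * l) * (2 * r)"
    using gap G3 by (intro mult_mono) auto
  finally have b4: "\<bar>\<Gamma>2 t\<bar> \<le> sqrt (2 * r * V / (m * g * l))"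
    by (intro real_le_rsqrt) (simp add: mult_ac)
  \<comment> \<open>This product is the difference between the slip velocity and
    \<open>v3\<close>.\<close>
  have "\<bar>l * \<Gamma>2 t * v2 t\<bar> \<le> l * r * \<kappa>"
    using G2 v2 pos r_pos by (auto simp: abs_mult intro!: mult_mono)
  then have b3: "\<bar>v3 t - Y\<bar> \<le> \<bar>w0 - Y\<bar> + \<eta> + l * r * \<kappa>" using drift by linarith
  have "dist (v1 t, v2 t, v3 t, \<Gamma>2 t, \<Gamma>3 t) (0, 0, Y, 0, 1)
      \<le> sqrt (2 * V / - A) + \<kappa> + (\<bar>w0 - Y\<bar> + \<eta> + l * r * \<kappa>) + sqrt (2 * r * V / (m * g * l))
        + (\<bar>r - 1\<bar> + V / (m * g * l))"
    using dist_quintuple_le[of "v1 t" "v2 t" "v3 t" "\<Gamma>2 t" "\<Gamma>3 t" 0 0 Y 0 1] b1 v2 b3 b4 b5 by simp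
  also have "\<dots> = skate_orbit_bound m l g A B2 B3 Y (v1 0, v2 0, v3 0, \<Gamma>2 0, \<Gamma>3 0)"
    by (simp add: skate_orbit_bound_def Let_def V_def \<kappa>_def \<eta>_def w0_def c_def r_def)
  finally show ?thesis by (simp add: B2_def B3_def)
qed

section \<open>Stability of the sliding equilibrium\<close>

text \<open>Every right-hand side vanishes at the upright state with \<open>v1 = v2 = 0\<close>,
  whatever \<open>Y\<close> is. Passing to the closed system avoids exhibiting a rotor
  angle.\<close>

lemma sliding_equilibrium:
  assumes "\<sigma> \<noteq> 0"
  shows "equilibrium (controlled_skate_solution m l g I1 I2 I3 J1 J2 J3 \<sigma>) (0, 0, Y, 0, 1)"
  unfolding equilibrium_def
proof (intro allI impI)
  fix T :: real assume "T > 0"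
  show "controlled_skate_solution m l g I1 I2 I3 J1 J2 J3 \<sigma> {0..T} (\<lambda>t. (0, 0, Y, 0, 1))"
    unfolding controlled_skate_solution_iff_closed_system[OF assms \<open>T > 0\<close>]
    by (rule conjI, simp, rule exI[of _ "\<lambda>t. 0"], rule exI[of _ "\<lambda>t. 0"], rule exI[of _ "\<lambda>t. Y"],
        rule exI[of _ "\<lambda>t. 0"], rule exI[of _ "\<lambda>t. 1"], rule exI[of _ "\<lambda>t. 0"])
      (simp add: skate_force_def skate_rotor_free_eqs_def)
qed

theorem proposition19:
  fixes m l g I1 I2 I3 J1 J2 J3 \<sigma> Y\<^sub>0 :: real
  assumes "m > 0" "l > 0" "g > 0"
    and "I1 > 0" "I2 > 0" "I3 > 0"
    and "J1 > 0" "J2 > 0" "J3 > 0"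
    and "I2 > I3"
    and "\<sigma> \<noteq> 0"
    and "- (J1\<^sup>2 / (I1 + m * l\<^sup>2)) < \<sigma>" "\<sigma> < 0"
  shows "lyapunov_stable (controlled_skate_solution m l g I1 I2 I3 J1 J2 J3 \<sigma>) (0, 0, Y\<^sub>0, 0, 1)"
proof -
  define A where "A = I1 + m * l\<^sup>2 + J1\<^sup>2 / \<sigma>"
  have "I1 + m * l\<^sup>2 > 0" using assms by (simp add: add_pos_pos)
  \<comment> \<open>Clearing the positive denominator and then dividing by
    \<open>\<sigma> < 0\<close> reverses the lower bound on \<open>\<sigma>\<close> into
    \<open>I1 + m * l\<^sup>2 < - (J1\<^sup>2 / \<sigma>)\<close>.\<close>
  then have "A < 0"
    using assms(12,13) by (simp add: A_def field_simps)
  then have pos: "m > 0" "l > 0" "g > 0" "I2 + J2 > 0" "I3 + J3 > 0" "A < 0"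
    using assms by simp_all
  show ?thesis
  proof (rule lyapunov_stableI[OF sliding_equilibrium[OF \<open>\<sigma> \<noteq> 0\<close>] skate_orbit_bound_tendsto[OF pos]])
    \<comment> \<open>Near the equilibrium \<open>\<Gamma>3\<close> stays away from 0, so the
      initial vertical vector is nonzero as \<open>skate_orbit_bound\<close> requires.\<close>
    have "open {z :: real \<times> real \<times> real \<times> real \<times> real. snd (snd (snd (snd z))) \<noteq> 0}"
      by (intro open_Collect_neq continuous_intros)
    from eventually_nhds_in_open[OF this, of "(0, 0, Y\<^sub>0, 0, 1)"]
    have "\<forall>\<^sub>F z :: real \<times> real \<times> real \<times> real \<times> real in nhds (0, 0, Y\<^sub>0, 0, 1).
        snd (snd (snd (snd z))) \<noteq> 0"
      by simp
    then show "\<forall>\<^sub>F z in nhds (0, 0, Y\<^sub>0, 0, 1). \<forall>T>0. \<forall>x.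
        controlled_skate_solution m l g I1 I2 I3 J1 J2 J3 \<sigma> {0..T} x \<longrightarrow> x 0 = z \<longrightarrow>
        (\<forall>t\<in>{0..T}. dist (x t) (0, 0, Y\<^sub>0, 0, 1)
          \<le> skate_orbit_bound m l g A (I2 + J2) (I3 + J3) Y\<^sub>0 z)"
    proof eventually_elim
      case (elim z)
      show ?case
      proof (intro allI impI ballI)
        fix T t :: real and x
        assume "T > 0" and sol: "controlled_skate_solution m l g I1 I2 I3 J1 J2 J3 \<sigma> {0..T} x"
          and z: "x 0 = z" and t: "t \<in> {0..T}"
        from sol[unfolded controlled_skate_solution_iff_closed_system[OF \<open>\<sigma> \<noteq> 0\<close> \<open>T > 0\<close>],
            folded A_def]
        obtain v1 v2 v3 \<Gamma>2 \<Gamma>3 a where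
          x: "x = (\<lambda>t. (v1 t, v2 t, v3 t, \<Gamma>2 t, \<Gamma>3 t))" and
          v1: "\<forall>t\<in>{0..T}. (v1 has_real_derivative a t) (at t within {0..T}) \<and>
             A * a t = skate_force m l g I2 I3 J2 J3 (v1 t, v2 t, v3 t, \<Gamma>2 t, \<Gamma>3 t)" and
          free: "skate_rotor_free_eqs m l I2 I3 J2 J3 {0..T} v1 v2 v3 \<Gamma>2 \<Gamma>3"
          by (elim conjE exE) (rule that)
        have "(\<Gamma>2 0, \<Gamma>3 0) \<noteq> (0, 0)" using elim z x by auto
        from skate_orbit_bound[OF pos v1 free this t]
        show "dist (x t) (0, 0, Y\<^sub>0, 0, 1) \<le> skate_orbit_bound m l g A (I2 + J2) (I3 + J3) Y\<^sub>0 z"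
          using z x by auto
      qed
    qed
  qed
qed

end
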